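(* Let $(M,\varphi,\xi,\eta,g)$ be a $(2n+1)$-dimensional para-Sasaki-like Riemannian manifold, let $\alpha,\beta$ be smooth functions on $M$, and let $\overline{\nabla}$ be the generalized symmetric metric connection on $M$ determined by $\alpha,\beta$. Let $R$ and $\overline{R}$ be the curvature tensors of the Levi-Civita connection $\nabla$ and of $\overline{\nabla}$, respectively. Then for all vector fields $x,y,z$ on $M$: $$\begin{aligned} \overline{R}(x,y)z={}&R(x,y)z+x(\alpha)g(y,z)\xi+(\alpha-\alpha\beta)g(y,z)\varphi x\\ &-x(\alpha)\eta(z)y+x(\beta)g(\varphi y,z)\xi+(2\beta-\beta^2)g(\varphi y,z)\varphi x\\ &-x(\beta)\eta(z)\varphi y+(\alpha^2+\beta)g(y,z)\eta(x)\xi+\alpha\beta g(\varphi y,z)\eta(x)\xi\\ &-\alpha^2g(y,z)x+(\alpha^2+\beta)\eta(y)\eta(z)x+(\alpha-\alpha\beta)g(\varphi y,z)x\\ &+\alpha\beta\,\eta(y)\eta(z)\varphi x-y(\alpha)g(x,z)\xi+y(\alpha)\eta(z)x\\ &-y(\beta)g(\varphi x,z)\xi+(\beta^2-2\beta)g(\varphi x,z)\varphi y+y(\beta)\eta(z)\varphi x\\ &-(\alpha^2+\beta)\eta(y)g(x,z)\xi-\alpha\beta g(\varphi x,z)\eta(y)\xi+\alpha^2g(x,z)y\\ &-(\alpha^2+\beta)\eta(x)\eta(z)y+(\alpha\beta-\alpha)g(\varphi x,z)y\\ &-\alpha\beta\,\eta(x)\eta(z)\varphi y+(\alpha\beta-\alpha)g(x,z)\varphi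 y. \end{aligned}$$
   Context: An almost paracontact almost paracomplex Riemannian manifold (apapR manifold) $(M,\varphi,\xi,\eta,g)$ is a differentiable manifold $M$ of dimension $2n+1$ with a $(1,1)$-tensor field $\varphi$, a vector field $\xi$, a $1$-form $\eta$ and a Riemannian metric $g$ such that, for all vector fields $x,y$: $\eta(\xi)=1$, $\varphi^2x=x-\eta(x)\xi$, $\varphi\xi=0$, $g(\varphi x,\varphi y)=g(x,y)-\eta(x)\eta(y)$, $\mathrm{tr}\,\varphi=0$. Consequently $g(x,\xi)=\eta(x)$ and $g(x,\varphi y)=g(\varphi x,y)$. With $\nabla$ the Levi-Civita connection of $g$, the apapR manifold is called para-Sasaki-like if $(\nabla_x\varphi)y=-g(x,y)\xi-\eta(y)x+2\eta(x)\eta(y)\xi$ for all vector fields $x,y$. The generalized symmetric metric connection determined by smooth functions $\alpha,\beta$ is $$\overline{\nabla}_xy=\nabla_xy+\alpha\{g(x,y)\xi-\eta(y)x\}+\beta\{g(\varphi x,y)\xi-\eta(y)\varphi x\}.$$ Curvature convention: $\overline{R}(x,y)z=\overline{\nabla}_x\overline{\nabla}_yz-\overline{\nabla}_y\overline{\nabla}_xz-\overline{\nabla}_{[x,y]}z$, and likewise for $R$ with $\nabla$. For a function $f$ and a vector field $x$, $x(f)$ denotes the derivative of $f$ along $x$. *)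

theory Defs
  imports "HOL-Analysis.Analysis" "HOL-Library.Function_Algebras"
begin

(* Pointwise scalar multiplication. Together with the pointwise ring structure of
   Function_Algebras it makes real-valued functions a commutative ring, and turns tangent
   vectors (functionals) and vector fields (families of functionals) into real vectors. *)

instantiation "fun" :: (type, real_vector) real_vector
begin

definition scaleR_fun :: "real \<Rightarrow> ('a \<Rightarrow> 'b) \<Rightarrow> 'a \<Rightarrow> 'b"
  where "scaleR_fun c f = (\<lambda>x. c *\<^sub>R f x)"

instance
  by standard (auto simp: scaleR_fun_def plus_fun_def scaleR_add_right scaleR_add_left)

end


subsection \<open>Smooth manifolds\<close>

(* Meant for open S. *)

primrec C_k_on :: "nat \<Rightarrow> 'a::real_normed_vector set \<Rightarrow> ('a \<Rightarrow> 'b::real_normed_vector) \<Rightarrow> bool"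
  where
    "C_k_on 0 S f \<longleftrightarrow> continuous_on S f"
  | "C_k_on (Suc k) S f \<longleftrightarrow>
       (\<forall>x\<in>S. f differentiable (at x)) \<and>
       (\<forall>v. C_k_on k S (\<lambda>x. frechet_derivative f (at x) v))"

definition smooth_on :: "'a::real_normed_vector set \<Rightarrow> ('a \<Rightarrow> 'b::real_normed_vector) \<Rightarrow> bool"
  where "smooth_on S f \<longleftrightarrow> (\<forall>k. C_k_on k S f)"

type_synonym ('a, 'e) atlas = "('a set \<times> ('a \<Rightarrow> 'e)) set"

(* The underlying set of the manifold is the whole type 'a, with its class topology; a chart is a
   pair of a domain and a coordinate map. The atlas is not required to be maximal: smoothness of
   functions on the manifold depends only on the maximal atlas generated by it. *)

definition smooth_manifold ::
    "('a::{t2_space, second_countable_topology}, 'e::euclidean_space) atlas \<Rightarrow> bool"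
  where "smooth_manifold A \<longleftrightarrow>
    (\<Union>(U, \<psi>)\<in>A. U) = UNIV \<and>
    (\<forall>(U, \<psi>)\<in>A. open U \<and> open (\<psi> ` U) \<and> homeomorphism U (\<psi> ` U) \<psi> (inv_into U \<psi>)) \<and>
    (\<forall>(U, \<psi>)\<in>A. \<forall>(V, \<theta>)\<in>A. smooth_on (\<psi> ` (U \<inter> V)) (\<theta> \<circ> inv_into U \<psi>))"

definition smooth_functions :: "('a, 'e::euclidean_space) atlas \<Rightarrow> ('a \<Rightarrow> real) set"
  where "smooth_functions A = {f. \<forall>(U, \<psi>)\<in>A. smooth_on (\<psi> ` U) (f \<circ> inv_into U \<psi>)}"


subsection \<open>Tangent vectors and tensor fields\<close>

type_synonym 'a tangent = "('a \<Rightarrow> real) \<Rightarrow> real"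

(* Tangent vectors at p are the derivations at p of the algebra of smooth functions. As HOL
   functions are total, the irrelevant value at a non-smooth function is fixed to be 0, so that
   equality in HOL is equality of derivations. *)

definition tangent_space :: "('a, 'e::euclidean_space) atlas \<Rightarrow> 'a \<Rightarrow> 'a tangent set"
  where "tangent_space A p = {v.
    (\<forall>f\<in>smooth_functions A. \<forall>h\<in>smooth_functions A. v (f + h) = v f + v h) \<and>
    (\<forall>c. \<forall>f\<in>smooth_functions A. v (c *\<^sub>R f) = c * v f) \<and>
    (\<forall>f\<in>smooth_functions A. \<forall>h\<in>smooth_functions A. v (f * h) = f p * v h + h p * v f) \<and>
    (\<forall>f. f \<notin> smooth_functions A \<longrightarrow> v f = 0)}"

(* The derivative x(f) of a function f along a vector field x. *)

definition dir :: "('a \<Rightarrow> 'a tangent) \<Rightarrow> ('a \<Rightarrow> real) \<Rightarrow> 'a \<Rightarrow> real"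
  where "dir x f = (\<lambda>p. x p f)"

definition vector_fields :: "('a, 'e::euclidean_space) atlas \<Rightarrow> ('a \<Rightarrow> 'a tangent) set"
  where "vector_fields A = {x.
    (\<forall>p. x p \<in> tangent_space A p) \<and>
    (\<forall>f\<in>smooth_functions A. dir x f \<in> smooth_functions A)}"

definition lie_bracket :: "('a \<Rightarrow> 'a tangent) \<Rightarrow> ('a \<Rightarrow> 'a tangent) \<Rightarrow> 'a \<Rightarrow> 'a tangent"
  where "lie_bracket x y = (\<lambda>p f. x p (dir y f) - y p (dir x f))"

definition fscale :: "('a \<Rightarrow> real) \<Rightarrow> ('a \<Rightarrow> 'b::real_vector) \<Rightarrow> 'a \<Rightarrow> 'b"  (infixr \<open>\<odot>\<close> 68)
  where "f \<odot> x = (\<lambda>p. f p *\<^sub>R x p)"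

(* Pointwise evaluation of a field of maps on a field of arguments: with a vector field x this
   yields the function eta(x), the vector field phi x, and (iterated) the function g(x,y). *)

definition fapp :: "('a \<Rightarrow> 'b \<Rightarrow> 'c) \<Rightarrow> ('a \<Rightarrow> 'b) \<Rightarrow> 'a \<Rightarrow> 'c"  (infixl \<open>\<diamondop>\<close> 90)
  where "T \<diamondop> x = (\<lambda>p. T p (x p))"

definition linear_on_set :: "'b::real_vector set \<Rightarrow> ('b \<Rightarrow> 'c::real_vector) \<Rightarrow> bool"
  where "linear_on_set S h \<longleftrightarrow>
    (\<forall>u\<in>S. \<forall>v\<in>S. h (u + v) = h u + h v) \<and> (\<forall>c. \<forall>u\<in>S. h (c *\<^sub>R u) = c *\<^sub>R h u)"

definition one_form :: "('a, 'e::euclidean_space) atlas \<Rightarrow> ('a \<Rightarrow> 'a tangent \<Rightarrow> real) \<Rightarrow> bool"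
  where "one_form A \<eta> \<longleftrightarrow>
    (\<forall>p. linear_on_set (tangent_space A p) (\<eta> p)) \<and>
    (\<forall>x\<in>vector_fields A. \<eta> \<diamondop> x \<in> smooth_functions A)"

definition tensor_1_1 ::
    "('a, 'e::euclidean_space) atlas \<Rightarrow> ('a \<Rightarrow> 'a tangent \<Rightarrow> 'a tangent) \<Rightarrow> bool"
  where "tensor_1_1 A \<phi> \<longleftrightarrow>
    (\<forall>p. linear_on_set (tangent_space A p) (\<phi> p) \<and>
         \<phi> p ` tangent_space A p \<subseteq> tangent_space A p) \<and>
    (\<forall>x\<in>vector_fields A. \<phi> \<diamondop> x \<in> vector_fields A)"

definition riemannian_metric ::
    "('a, 'e::euclidean_space) atlas \<Rightarrow> ('a \<Rightarrow> 'a tangent \<Rightarrow> 'a tangent \<Rightarrow> real) \<Rightarrow> bool"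
  where "riemannian_metric A g \<longleftrightarrow>
    (\<forall>p. \<forall>u\<in>tangent_space A p. linear_on_set (tangent_space A p) (g p u)) \<and>
    (\<forall>p. \<forall>u\<in>tangent_space A p. \<forall>v\<in>tangent_space A p. g p u v = g p v u) \<and>
    (\<forall>p. \<forall>u\<in>tangent_space A p. u \<noteq> 0 \<longrightarrow> g p u u > 0) \<and>
    (\<forall>x\<in>vector_fields A. \<forall>y\<in>vector_fields A. g \<diamondop> x \<diamondop> y \<in> smooth_functions A)"

(* Trace of an endomorphism h of a finite-dimensional subspace S, computed in some basis of S
   (the value does not depend on the basis). *)

definition trace_on :: "'b::real_vector set \<Rightarrow> ('b \<Rightarrow> 'b) \<Rightarrow> real"
  where "trace_on S h =
    (let B = (SOME B. independent B \<and> span B = S) in \<Sum>b\<in>B. representation B (h b) b)"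


subsection \<open>Connections and curvature\<close>

type_synonym 'a connection = "('a \<Rightarrow> 'a tangent) \<Rightarrow> ('a \<Rightarrow> 'a tangent) \<Rightarrow> ('a \<Rightarrow> 'a tangent)"

definition affine_connection :: "('a, 'e::euclidean_space) atlas \<Rightarrow> 'a connection \<Rightarrow> bool"
  where "affine_connection A D \<longleftrightarrow>
    (\<forall>x\<in>vector_fields A. \<forall>y\<in>vector_fields A. D x y \<in> vector_fields A) \<and>
    (\<forall>x\<in>vector_fields A. \<forall>y\<in>vector_fields A. \<forall>z\<in>vector_fields A.
       D (x + y) z = D x z + D y z \<and> D x (y + z) = D x y + D x z) \<and>
    (\<forall>f\<in>smooth_functions A. \<forall>x\<in>vector_fields A. \<forall>y\<in>vector_fields A.
       D (f \<odot> x) y = f \<odot> D x y \<and> D x (f \<odot> y) = dir x f \<odot> y + f \<odot> D x y)"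

definition levi_civita ::
    "('a, 'e::euclidean_space) atlas \<Rightarrow> ('a \<Rightarrow> 'a tangent \<Rightarrow> 'a tangent \<Rightarrow> real)
      \<Rightarrow> 'a connection \<Rightarrow> bool"
  where "levi_civita A g D \<longleftrightarrow>
    affine_connection A D \<and>
    (\<forall>x\<in>vector_fields A. \<forall>y\<in>vector_fields A. D x y - D y x = lie_bracket x y) \<and>
    (\<forall>x\<in>vector_fields A. \<forall>y\<in>vector_fields A. \<forall>z\<in>vector_fields A.
       dir x (g \<diamondop> y \<diamondop> z) = g \<diamondop> D x y \<diamondop> z + g \<diamondop> y \<diamondop> D x z)"

definition curvature ::
    "'a connection \<Rightarrow> ('a \<Rightarrow> 'a tangent) \<Rightarrow> ('a \<Rightarrow> 'a tangent) \<Rightarrow> ('a \<Rightarrow> 'a tangent)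
      \<Rightarrow> ('a \<Rightarrow> 'a tangent)"
  where "curvature D x y z = D x (D y z) - D y (D x z) - D (lie_bracket x y) z"


subsection \<open>Almost paracontact almost paracomplex Riemannian manifolds\<close>

locale apapR_manifold =
  fixes A :: "('a::{t2_space, second_countable_topology}, 'e::euclidean_space) atlas"
    and n :: nat
    and \<phi> :: "'a \<Rightarrow> 'a tangent \<Rightarrow> 'a tangent"
    and \<xi> :: "'a \<Rightarrow> 'a tangent"
    and \<eta> :: "'a \<Rightarrow> 'a tangent \<Rightarrow> real"
    and g :: "'a \<Rightarrow> 'a tangent \<Rightarrow> 'a tangent \<Rightarrow> real"
  assumes manifold: "smooth_manifold A"
    and dimension: "DIM('e) = 2 * n + 1"
    and phi_tensor: "tensor_1_1 A \<phi>"
    and xi_field: "\<xi> \<in> vector_fields A"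
    and eta_form: "one_form A \<eta>"
    and metric: "riemannian_metric A g"
    and eta_xi: "\<eta> \<diamondop> \<xi> = 1"
    and phi_phi: "x \<in> vector_fields A \<Longrightarrow> \<phi> \<diamondop> (\<phi> \<diamondop> x) = x - \<eta> \<diamondop> x \<odot> \<xi>"
    and phi_xi: "\<phi> \<diamondop> \<xi> = 0"
    and g_phi_phi: "x \<in> vector_fields A \<Longrightarrow> y \<in> vector_fields A \<Longrightarrow>
      g \<diamondop> (\<phi> \<diamondop> x) \<diamondop> (\<phi> \<diamondop> y) = g \<diamondop> x \<diamondop> y - (\<eta> \<diamondop> x) * (\<eta> \<diamondop> y)"
    and trace_phi: "trace_on (tangent_space A p) (\<phi> p) = 0"

(* D is meant to be the Levi-Civita connection of g; note that
   (D_x phi) y = D_x (phi y) - phi (D_x y). *)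

definition para_Sasaki_like ::
    "('a, 'e::euclidean_space) atlas \<Rightarrow> ('a \<Rightarrow> 'a tangent \<Rightarrow> 'a tangent) \<Rightarrow> ('a \<Rightarrow> 'a tangent)
      \<Rightarrow> ('a \<Rightarrow> 'a tangent \<Rightarrow> real) \<Rightarrow> ('a \<Rightarrow> 'a tangent \<Rightarrow> 'a tangent \<Rightarrow> real)
      \<Rightarrow> 'a connection \<Rightarrow> bool"
  where "para_Sasaki_like A \<phi> \<xi> \<eta> g D \<longleftrightarrow>
    (\<forall>x\<in>vector_fields A. \<forall>y\<in>vector_fields A.
       D x (\<phi> \<diamondop> y) - \<phi> \<diamondop> D x y =
         - (g \<diamondop> x \<diamondop> y \<odot> \<xi>) - \<eta> \<diamondop> y \<odot> x + (2 * (\<eta> \<diamondop> x) * (\<eta> \<diamondop> y)) \<odot> \<xi>)"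

definition generalized_symmetric_metric_connection ::
    "('a \<Rightarrow> 'a tangent \<Rightarrow> 'a tangent) \<Rightarrow> ('a \<Rightarrow> 'a tangent)
      \<Rightarrow> ('a \<Rightarrow> 'a tangent \<Rightarrow> real) \<Rightarrow> ('a \<Rightarrow> 'a tangent \<Rightarrow> 'a tangent \<Rightarrow> real)
      \<Rightarrow> 'a connection \<Rightarrow> ('a \<Rightarrow> real) \<Rightarrow> ('a \<Rightarrow> real) \<Rightarrow> 'a connection"
  where "generalized_symmetric_metric_connection \<phi> \<xi> \<eta> g D \<alpha> \<beta> x y =
    D x y
    + \<alpha> \<odot> (g \<diamondop> x \<diamondop> y \<odot> \<xi> - \<eta> \<diamondop> y \<odot> x)
    + \<beta> \<odot> (g \<diamondop> (\<phi> \<diamondop> x) \<diamondop> y \<odot> \<xi> - \<eta> \<diamondop> y \<odot> (\<phi> \<diamondop> x))"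

end

theory Submission
  imports Defs
begin

text \<open>
  Write $\overline\nabla = \nabla + T$ with the tensor
  $T(x,y) = \alpha\{g(x,y)\xi - \eta(y)x\} + \beta\{g(\varphi x,y)\xi - \eta(y)\varphi x\}$. Since
  $\nabla$ is torsion free,
  \[\overline R(x,y)z = R(x,y)z + (\nabla_x T)(y,z) - (\nabla_y T)(x,z)
    + T(x,T(y,z)) - T(y,T(x,z)).\]
  Setting $y = \xi$ in the para-Sasaki-like condition gives $\nabla_x\xi = \varphi x$, hence
  $(\nabla_x\eta)(y) = g(\varphi x,y)$. With the condition itself for $\nabla\varphi$, this makes
  $\nabla T$ explicit.
\<close>

section \<open>Algebra of smooth functions\<close>

text \<open>A derivative at a point of the open set \<open>S\<close> sees only nearby values, so
  functions that agree on \<open>S\<close> have equal derivatives there. The sum and product rules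
  below are identities on \<open>S\<close> only, and regularity is transferred along them in this
  way.\<close>

lemma C_k_on_cong:
  assumes "open S" and "\<And>x. x \<in> S \<Longrightarrow> f x = h x" and "C_k_on k S f"
  shows "C_k_on k S h"
  using assms(2,3)
proof (induction k arbitrary: f h)
  case 0
  then show ?case
    using continuous_on_cong by fastforce
next
  case (Suc k)
  have der: "(h has_derivative frechet_derivative f (at x)) (at x)" if "x \<in> S" for x
  proof -
    have "(f has_derivative frechet_derivative f (at x)) (at x)"
      using Suc.prems(2) that by (simp add: frechet_derivative_works)
    then show ?thesis
      using has_derivative_transform_within_open[OF _ assms(1) that] Suc.prems(1) by blast
  qed
  have "C_k_on k S (\<lambda>x. frechet_derivative h (at x) v)" for v
  proof (rule Suc.IH)
    show "C_k_on k S (\<lambda>x. frechet_derivative f (at x) v)"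
      using Suc.prems(2) by simp
    show "frechet_derivative f (at x) v = frechet_derivative h (at x) v" if "x \<in> S" for x
      using frechet_derivative_at[OF der[OF that]] by simp
  qed
  then show ?case
    using der by (auto simp: differentiable_def)
qed

text \<open>Differentiable functions are continuous; above order 0 the claim passes to the
  directional derivatives. It serves the product rule, where undifferentiated factors
  remain.\<close>

lemma C_k_on_Suc_imp_C_k_on: "C_k_on (Suc k) S f \<Longrightarrow> C_k_on k S f"
proof (induction k arbitrary: f)
  case 0
  then show ?case
    by (auto intro!: continuous_at_imp_continuous_on differentiable_imp_continuous_within)
next
  case (Suc k)
  show ?case
    using Suc.prems Suc.IH by (metis C_k_on.simps(2))
qed

lemma C_k_on_add:
  assumes "open S"
  shows "C_k_on k S f \<Longrightarrow> C_k_on k S h \<Longrightarrow> C_k_on k S (\<lambda>x. f x + h x)"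
proof (induction k arbitrary: f h)
  case 0
  then show ?case
    by (simp add: continuous_on_add)
next
  case (Suc k)
  have der: "frechet_derivative (\<lambda>x. f x + h x) (at x) v
      = frechet_derivative f (at x) v + frechet_derivative h (at x) v" if "x \<in> S" for x v
    using Suc.prems that
    by (intro fun_cong[OF frechet_derivative_at, symmetric] has_derivative_add)
      (auto simp: frechet_derivative_works)
  have "C_k_on k S (\<lambda>x. frechet_derivative (\<lambda>x. f x + h x) (at x) v)" for v
    using C_k_on_cong[OF assms _ Suc.IH] der Suc.prems by simp
  then show ?case
    using Suc.prems by simp
qed

lemma C_k_on_mult:
  fixes f h :: "'a::real_normed_vector \<Rightarrow> 'b::real_normed_algebra"
  assumes "open S"
  shows "C_k_on k S f \<Longrightarrow> C_k_on k S h \<Longrightarrow> C_k_on k S (\<lambda>x. f x * h x)"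
proof (induction k arbitrary: f h)
  case 0
  then show ?case
    by (simp add: continuous_on_mult)
next
  case (Suc k)
  have der: "frechet_derivative (\<lambda>x. f x * h x) (at x) v
      = f x * frechet_derivative h (at x) v + frechet_derivative f (at x) v * h x"
    if "x \<in> S" for x v
    using Suc.prems that
    by (intro fun_cong[OF frechet_derivative_at, symmetric] has_derivative_mult)
      (auto simp: frechet_derivative_works)
  \<comment> \<open>Factors without a derivative have order \<open>Suc k\<close>, one more than the
    induction hypothesis takes, and are lowered to \<open>k\<close>.\<close>
  have "C_k_on k S (\<lambda>x. f x * frechet_derivative h (at x) v
      + frechet_derivative f (at x) v * h x)" for v
    using Suc.prems C_k_on_Suc_imp_C_k_on
    by (intro C_k_on_add[OF assms] Suc.IH) (auto simp del: C_k_on.simps(1))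
  then have "C_k_on k S (\<lambda>x. frechet_derivative (\<lambda>x. f x * h x) (at x) v)" for v
    by (rule C_k_on_cong[OF assms, rotated]) (simp add: der)
  then show ?case
    using Suc.prems by simp
qed

text \<open>The derivative is again a constant, namely 0, so the induction has to vary
  \<open>c\<close>.\<close>

lemma C_k_on_const: "C_k_on k S (\<lambda>x. c)"
  by (induction k arbitrary: c) (simp_all add: continuous_on_const frechet_derivative_const)

section \<open>The ring of smooth functions on the manifold\<close>

lemma smooth_functions_const: "(\<lambda>p. c) \<in> smooth_functions A"
  by (simp add: smooth_functions_def smooth_on_def C_k_on_const o_def)

lemma smooth_functions_one: "1 \<in> smooth_functions A"
  using smooth_functions_const[of 1] by (simp add: one_fun_def)

lemma smooth_functions_minus_one: "- 1 \<in> smooth_functions A"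
  using smooth_functions_const[of "- 1"] by (simp add: one_fun_def fun_Compl_def)

lemma smooth_functions_add:
  assumes "smooth_manifold A" "f \<in> smooth_functions A" "h \<in> smooth_functions A"
  shows "f + h \<in> smooth_functions A"
proof -
  have "C_k_on k (\<psi> ` U) ((f + h) \<circ> inv_into U \<psi>)" if "(U, \<psi>) \<in> A" for U \<psi> k
    using C_k_on_add[of "\<psi> ` U" k "f \<circ> inv_into U \<psi>" "h \<circ> inv_into U \<psi>"] assms that
    by (fastforce simp: smooth_functions_def smooth_on_def smooth_manifold_def o_def)
  then show ?thesis
    by (auto simp: smooth_functions_def smooth_on_def)
qed

lemma smooth_functions_mult:
  assumes "smooth_manifold A" "f \<in> smooth_functions A" "h \<in> smooth_functions A"
  shows "f * h \<in> smooth_functions A"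
proof -
  have "C_k_on k (\<psi> ` U) ((f * h) \<circ> inv_into U \<psi>)" if "(U, \<psi>) \<in> A" for U \<psi> k
    using C_k_on_mult[of "\<psi> ` U" k "f \<circ> inv_into U \<psi>" "h \<circ> inv_into U \<psi>"] assms that
    by (fastforce simp: smooth_functions_def smooth_on_def smooth_manifold_def o_def)
  then show ?thesis
    by (auto simp: smooth_functions_def smooth_on_def)
qed

section \<open>The module of vector fields\<close>

lemma tangent_space_add:
  "u \<in> tangent_space A p \<Longrightarrow> v \<in> tangent_space A p \<Longrightarrow> u + v \<in> tangent_space A p"
  by (auto simp: tangent_space_def algebra_simps)

lemma tangent_space_scaleR:
  "u \<in> tangent_space A p \<Longrightarrow> c *\<^sub>R u \<in> tangent_space A p"
  by (auto simp: tangent_space_def scaleR_fun_def algebra_simps)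

lemma vector_field_in_tangent_space: "x \<in> vector_fields A \<Longrightarrow> x p \<in> tangent_space A p"
  by (simp add: vector_fields_def)

lemma vector_fields_add:
  assumes "smooth_manifold A" "x \<in> vector_fields A" "y \<in> vector_fields A"
  shows "x + y \<in> vector_fields A"
proof -
  have "dir (x + y) f = dir x f + dir y f" for f
    by (simp add: dir_def fun_eq_iff)
  then show ?thesis
    using assms by (auto simp: vector_fields_def tangent_space_add smooth_functions_add)
qed

lemma vector_fields_fscale:
  assumes "smooth_manifold A" "f \<in> smooth_functions A" "x \<in> vector_fields A"
  shows "f \<odot> x \<in> vector_fields A"
proof -
  have "dir (f \<odot> x) h = f * dir x h" for h
    by (simp add: dir_def fun_eq_iff fscale_def scaleR_fun_def)
  then show ?thesis
    using assms
    by (auto simp: vector_fields_def tangent_space_scaleR smooth_functions_mult fscale_def)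
qed

text \<open>These rules turn an equation between vector fields into one between real numbers, at
  each point and each test function, where \<open>algebra_simps\<close> can decide it.\<close>

lemmas pointwise = fscale_def scaleR_fun_def fun_eq_iff

lemma minus_eq_fscale: "- x = (- 1) \<odot> x"
  by (simp add: fscale_def fun_eq_iff)

lemma vector_fields_uminus:
  assumes "smooth_manifold A" "x \<in> vector_fields A"
  shows "- x \<in> vector_fields A"
  unfolding minus_eq_fscale[of x]
  using assms by (simp add: vector_fields_fscale smooth_functions_minus_one)

lemma vector_fields_diff:
  assumes "smooth_manifold A" "x \<in> vector_fields A" "y \<in> vector_fields A"
  shows "x - y \<in> vector_fields A"
  using vector_fields_add[OF assms(1,2) vector_fields_uminus[OF assms(1,3)]] by simp

text \<open>The Leibniz rule on 1 * 1 = 1 gives x(1) = 2 x(1). It is later applied to the constant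
  function g(\<xi>, \<xi>) = 1.\<close>

lemma dir_one:
  assumes "x \<in> vector_fields A"
  shows "dir x 1 = 0"
proof
  fix p
  have "x p (1 * 1) = 1 p * x p 1 + 1 p * x p 1"
    using vector_field_in_tangent_space[OF assms, of p] smooth_functions_one[of A]
    unfolding tangent_space_def by blast
  then show "dir x 1 p = 0 p"
    by (simp add: dir_def)
qed

section \<open>Para-Sasaki-like manifolds\<close>

context apapR_manifold
begin

lemmas smooth_closed =
  smooth_functions_add[OF manifold] smooth_functions_mult[OF manifold]

lemmas field_closed =
  vector_fields_add[OF manifold] vector_fields_fscale[OF manifold]
  vector_fields_uminus[OF manifold] vector_fields_diff[OF manifold] xi_field

lemma phi_field: "x \<in> vector_fields A \<Longrightarrow> \<phi> \<diamondop> x \<in> vector_fields A"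
  using phi_tensor by (simp add: tensor_1_1_def)

lemma eta_smooth: "x \<in> vector_fields A \<Longrightarrow> \<eta> \<diamondop> x \<in> smooth_functions A"
  using eta_form by (simp add: one_form_def)

lemma g_smooth:
  "x \<in> vector_fields A \<Longrightarrow> y \<in> vector_fields A \<Longrightarrow> g \<diamondop> x \<diamondop> y \<in> smooth_functions A"
  using metric by (simp add: riemannian_metric_def)

lemmas closed = smooth_closed field_closed phi_field eta_smooth g_smooth

section \<open>Bilinearity of the metric on vector fields\<close>

lemma g_commute:
  "x \<in> vector_fields A \<Longrightarrow> y \<in> vector_fields A \<Longrightarrow> g \<diamondop> x \<diamondop> y = g \<diamondop> y \<diamondop> x"
  using metric
  by (simp add: riemannian_metric_def fapp_def fun_eq_iff vector_field_in_tangent_space)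

lemma g_add_right:
  "\<lbrakk>x \<in> vector_fields A; y \<in> vector_fields A; z \<in> vector_fields A\<rbrakk>
    \<Longrightarrow> g \<diamondop> x \<diamondop> (y + z) = g \<diamondop> x \<diamondop> y + g \<diamondop> x \<diamondop> z"
  using metric
  by (simp add: riemannian_metric_def linear_on_set_def fapp_def fun_eq_iff
      vector_field_in_tangent_space)

lemma g_fscale_right:
  "\<lbrakk>x \<in> vector_fields A; y \<in> vector_fields A\<rbrakk> \<Longrightarrow> g \<diamondop> x \<diamondop> (f \<odot> y) = f * (g \<diamondop> x \<diamondop> y)"
  using metric
  by (simp add: riemannian_metric_def linear_on_set_def fapp_def fscale_def fun_eq_iff
      vector_field_in_tangent_space)

lemma g_uminus_right:
  "\<lbrakk>x \<in> vector_fields A; y \<in> vector_fields A\<rbrakk> \<Longrightarrow> g \<diamondop> x \<diamondop> (- y) = - (g \<diamondop> x \<diamondop> y)"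
  using g_fscale_right[of x y "- 1"] by (simp add: minus_eq_fscale[of y])

lemma g_diff_right:
  "\<lbrakk>x \<in> vector_fields A; y \<in> vector_fields A; z \<in> vector_fields A\<rbrakk>
    \<Longrightarrow> g \<diamondop> x \<diamondop> (y - z) = g \<diamondop> x \<diamondop> y - g \<diamondop> x \<diamondop> z"
  using g_add_right[of x y "- z"] by (simp add: g_uminus_right closed)

text \<open>Linearity in the second slot is part of the definition of a metric; here and in the next
  three lemmas symmetry carries it to the first slot. Symmetry is available for vector fields, and
  in \<open>g_fscale_left\<close> smoothness of \<open>f\<close> makes \<open>f \<odot> y\<close>
  one.\<close>

lemma g_add_left:
  "\<lbrakk>x \<in> vector_fields A; y \<in> vector_fields A; z \<in> vector_fields A\<rbrakk>
    \<Longrightarrow> g \<diamondop> (y + z) \<diamondop> x = g \<diamondop> y \<diamondop> x + g \<diamondop> z \<diamondop> x"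
  using g_add_right g_commute closed(3) by metis

lemma g_diff_left:
  "\<lbrakk>x \<in> vector_fields A; y \<in> vector_fields A; z \<in> vector_fields A\<rbrakk>
    \<Longrightarrow> g \<diamondop> (y - z) \<diamondop> x = g \<diamondop> y \<diamondop> x - g \<diamondop> z \<diamondop> x"
  using g_diff_right g_commute vector_fields_diff[OF manifold] by metis

lemma g_uminus_left:
  "\<lbrakk>x \<in> vector_fields A; y \<in> vector_fields A\<rbrakk> \<Longrightarrow> g \<diamondop> (- y) \<diamondop> x = - (g \<diamondop> y \<diamondop> x)"
  using g_uminus_right g_commute vector_fields_uminus[OF manifold] by metis

lemma g_fscale_left:
  "\<lbrakk>x \<in> vector_fields A; y \<in> vector_fields A; f \<in> smooth_functions A\<rbrakk>
    \<Longrightarrow> g \<diamondop> (f \<odot> y) \<diamondop> x = f * (g \<diamondop> y \<diamondop> x)"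
  using g_fscale_right g_commute vector_fields_fscale[OF manifold] by metis

lemmas g_linear =
  g_add_right g_diff_right g_uminus_right g_fscale_right
  g_add_left g_diff_left g_uminus_left g_fscale_left

section \<open>Algebraic relations between \<phi>, \<eta> and the metric\<close>

lemma phi_add:
  "\<lbrakk>x \<in> vector_fields A; y \<in> vector_fields A\<rbrakk> \<Longrightarrow> \<phi> \<diamondop> (x + y) = \<phi> \<diamondop> x + \<phi> \<diamondop> y"
  using phi_tensor
  by (simp add: tensor_1_1_def linear_on_set_def fapp_def fun_eq_iff
      vector_field_in_tangent_space)

lemma phi_fscale: "x \<in> vector_fields A \<Longrightarrow> \<phi> \<diamondop> (f \<odot> x) = f \<odot> (\<phi> \<diamondop> x)"
  using phi_tensor
  by (simp add: tensor_1_1_def linear_on_set_def fapp_def fscale_def fun_eq_iff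
      vector_field_in_tangent_space)

lemma phi_diff:
  assumes "x \<in> vector_fields A" "y \<in> vector_fields A"
  shows "\<phi> \<diamondop> (x - y) = \<phi> \<diamondop> x - \<phi> \<diamondop> y"
  using phi_add[of "x - y" y] assms by (simp add: closed)

text \<open>Put y = \<xi> in \<open>g_phi_phi\<close>: the left side vanishes because \<phi> \<xi> =
  0, and \<eta>(\<xi>) = 1 on the right. Linearity of \<eta> on fields is then inherited from the
  metric.\<close>

lemma eta_eq_g_xi:
  assumes "x \<in> vector_fields A"
  shows "\<eta> \<diamondop> x = g \<diamondop> x \<diamondop> \<xi>"
proof -
  have "g \<diamondop> (\<phi> \<diamondop> x) \<diamondop> 0 = 0"
    using g_diff_right[of "\<phi> \<diamondop> x" "\<phi> \<diamondop> x" "\<phi> \<diamondop> x"] assms by (simp add: closed)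
  then show ?thesis
    using g_phi_phi[OF assms xi_field] by (simp add: phi_xi eta_xi)
qed

lemma eta_add:
  "\<lbrakk>x \<in> vector_fields A; y \<in> vector_fields A\<rbrakk> \<Longrightarrow> \<eta> \<diamondop> (x + y) = \<eta> \<diamondop> x + \<eta> \<diamondop> y"
  by (simp add: eta_eq_g_xi g_linear closed)

lemma eta_diff:
  "\<lbrakk>x \<in> vector_fields A; y \<in> vector_fields A\<rbrakk> \<Longrightarrow> \<eta> \<diamondop> (x - y) = \<eta> \<diamondop> x - \<eta> \<diamondop> y"
  by (simp add: eta_eq_g_xi g_linear closed)

lemma eta_fscale:
  "\<lbrakk>f \<in> smooth_functions A; x \<in> vector_fields A\<rbrakk> \<Longrightarrow> \<eta> \<diamondop> (f \<odot> x) = f * (\<eta> \<diamondop> x)"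
  by (simp add: eta_eq_g_xi g_linear closed)

text \<open>Compute the third power of \<phi> on x in two ways. Applying \<phi> to \<phi>(\<phi> x)
  gives \<phi> x, since \<phi> \<xi> = 0; applying \<open>phi_phi\<close> to \<phi> x gives \<phi> x
  - \<eta>(\<phi> x) \<xi>. Pairing the difference with \<xi> isolates the coefficient.\<close>

lemma eta_phi:
  assumes "x \<in> vector_fields A"
  shows "\<eta> \<diamondop> (\<phi> \<diamondop> x) = 0"
proof -
  let ?f = "\<eta> \<diamondop> (\<phi> \<diamondop> x)"
  have "\<phi> \<diamondop> (\<phi> \<diamondop> (\<phi> \<diamondop> x)) = \<phi> \<diamondop> x"
    using assms by (simp add: phi_phi[OF assms] phi_diff phi_fscale closed phi_xi)
      (simp add: pointwise)
  then have "?f \<odot> \<xi> = 0"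
    using phi_phi[OF phi_field[OF assms]] by simp
  then have "g \<diamondop> \<xi> \<diamondop> (?f \<odot> \<xi>) = 0"
    using g_diff_right[of \<xi> \<xi> \<xi>] by (simp add: closed)
  then show ?thesis
    using eta_eq_g_xi[OF xi_field] by (simp add: g_fscale_right closed eta_xi)
qed

text \<open>Put \<phi> x for x in \<open>g_phi_phi\<close>. The correction terms, on the right and
  inside \<phi>(\<phi> x), both vanish by \<open>eta_phi\<close>.\<close>

lemma g_phi_commute:
  assumes "x \<in> vector_fields A" "y \<in> vector_fields A"
  shows "g \<diamondop> x \<diamondop> (\<phi> \<diamondop> y) = g \<diamondop> (\<phi> \<diamondop> x) \<diamondop> y"
proof -
  have "g \<diamondop> (\<phi> \<diamondop> (\<phi> \<diamondop> x)) \<diamondop> (\<phi> \<diamondop> y) = g \<diamondop> x \<diamondop> (\<phi> \<diamondop> y)"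
    using assms eta_phi[of y] g_commute[of \<xi> "\<phi> \<diamondop> y"] eta_eq_g_xi[of "\<phi> \<diamondop> y"]
    by (simp add: phi_phi g_linear closed)
  then show ?thesis
    using g_phi_phi[of "\<phi> \<diamondop> x" y] assms by (simp add: closed eta_phi)
qed

end

section \<open>The Levi-Civita connection acting on the structure tensors\<close>

locale para_Sasaki_like_manifold = apapR_manifold +
  fixes D :: "'a::{t2_space, second_countable_topology} connection"
  assumes levi_civita: "levi_civita A g D"
    and para_Sasaki: "para_Sasaki_like A \<phi> \<xi> \<eta> g D"
begin

lemma D_field: "x \<in> vector_fields A \<Longrightarrow> y \<in> vector_fields A \<Longrightarrow> D x y \<in> vector_fields A"
  using levi_civita by (simp add: levi_civita_def affine_connection_def)

lemma D_add:
  "\<lbrakk>x \<in> vector_fields A; y \<in> vector_fields A; z \<in> vector_fields A\<rbrakk>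
    \<Longrightarrow> D x (y + z) = D x y + D x z"
  using levi_civita by (simp add: levi_civita_def affine_connection_def)

lemma D_fscale:
  "\<lbrakk>f \<in> smooth_functions A; x \<in> vector_fields A; y \<in> vector_fields A\<rbrakk>
    \<Longrightarrow> D x (f \<odot> y) = dir x f \<odot> y + f \<odot> D x y"
  using levi_civita by (simp add: levi_civita_def affine_connection_def)

lemma D_diff:
  "\<lbrakk>x \<in> vector_fields A; y \<in> vector_fields A; z \<in> vector_fields A\<rbrakk>
    \<Longrightarrow> D x (y - z) = D x y - D x z"
  using D_add[of x "y - z" z] by (simp add: closed)

lemma lie_bracket_eq:
  "x \<in> vector_fields A \<Longrightarrow> y \<in> vector_fields A \<Longrightarrow> lie_bracket x y = D x y - D y x"
  using levi_civita by (simp add: levi_civita_def)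

lemma dir_g:
  "\<lbrakk>x \<in> vector_fields A; y \<in> vector_fields A; z \<in> vector_fields A\<rbrakk>
    \<Longrightarrow> dir x (g \<diamondop> y \<diamondop> z) = g \<diamondop> D x y \<diamondop> z + g \<diamondop> y \<diamondop> D x z"
  using levi_civita by (simp add: levi_civita_def)

lemma D_phi:
  assumes "x \<in> vector_fields A" "y \<in> vector_fields A"
  shows "D x (\<phi> \<diamondop> y) = \<phi> \<diamondop> D x y
    + (- (g \<diamondop> x \<diamondop> y \<odot> \<xi>) - \<eta> \<diamondop> y \<odot> x + (2 * (\<eta> \<diamondop> x) * (\<eta> \<diamondop> y)) \<odot> \<xi>)"
  using para_Sasaki assms unfolding para_Sasaki_like_def by (metis add.commute diff_add_cancel)

text \<open>The condition at y = \<xi> only determines \<phi>(D x \<xi>) = x - \<eta>(x) \<xi>.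
  Applying \<phi> again recovers D x \<xi> up to its \<xi>-component, which is zero because g(\<xi>,
  \<xi>) is constant.\<close>

lemma D_xi:
  assumes "x \<in> vector_fields A"
  shows "D x \<xi> = \<phi> \<diamondop> x"
proof -
  have "g \<diamondop> D x \<xi> \<diamondop> \<xi> + g \<diamondop> D x \<xi> \<diamondop> \<xi> = 0"
    using dir_g[OF assms xi_field xi_field] eta_eq_g_xi[OF xi_field] dir_one[OF assms]
      g_commute[OF xi_field D_field[OF assms xi_field]] by (simp add: eta_xi)
  then have "g \<diamondop> D x \<xi> \<diamondop> \<xi> = 0"
    by (simp add: fun_eq_iff)
  then have eta: "\<eta> \<diamondop> D x \<xi> = 0"
    using assms by (simp add: eta_eq_g_xi closed D_field)
  \<comment> \<open>This is the left side of \<open>D_phi\<close> at \<xi>, since \<phi> \<xi> =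
    0.\<close>
  have "D x 0 = 0"
    using D_diff[of x \<xi> \<xi>] assms by (simp add: closed)
  then have "\<phi> \<diamondop> D x \<xi> = x - \<eta> \<diamondop> x \<odot> \<xi>"
    using D_phi[OF assms xi_field]
    by (simp add: phi_xi eta_xi eta_eq_g_xi[OF assms] pointwise algebra_simps)
  then have "\<phi> \<diamondop> (\<phi> \<diamondop> D x \<xi>) = \<phi> \<diamondop> x"
    using assms by (simp add: phi_diff phi_fscale closed phi_xi) (simp add: pointwise)
  then show ?thesis
    using phi_phi[of "D x \<xi>"] eta assms by (simp add: D_field closed fscale_def fun_eq_iff)
qed

text \<open>Differentiate \<eta>(y) = g(y, \<xi>) by metric compatibility and insert D x \<xi> =
  \<phi> x.\<close>

lemma dir_eta:
  assumes "x \<in> vector_fields A" "y \<in> vector_fields A"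
  shows "dir x (\<eta> \<diamondop> y) = \<eta> \<diamondop> D x y + g \<diamondop> (\<phi> \<diamondop> x) \<diamondop> y"
  using dir_g[OF assms xi_field] assms g_commute[of y "\<phi> \<diamondop> x"]
  by (simp add: eta_eq_g_xi closed D_field D_xi)

end

section \<open>The generalized symmetric metric connection\<close>

locale deformed_para_Sasaki_like_manifold = para_Sasaki_like_manifold +
  fixes \<alpha> \<beta> :: "'a::{t2_space, second_countable_topology} \<Rightarrow> real"
  assumes alpha_smooth: "\<alpha> \<in> smooth_functions A"
    and beta_smooth: "\<beta> \<in> smooth_functions A"
begin

definition deformation ::
    "('a \<Rightarrow> 'a tangent) \<Rightarrow> ('a \<Rightarrow> 'a tangent) \<Rightarrow> ('a \<Rightarrow> 'a tangent)"
  where "deformation x y =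
    \<alpha> \<odot> (g \<diamondop> x \<diamondop> y \<odot> \<xi> - \<eta> \<diamondop> y \<odot> x)
    + \<beta> \<odot> (g \<diamondop> (\<phi> \<diamondop> x) \<diamondop> y \<odot> \<xi> - \<eta> \<diamondop> y \<odot> (\<phi> \<diamondop> x))"

abbreviation "Dbar \<equiv> generalized_symmetric_metric_connection \<phi> \<xi> \<eta> g D \<alpha> \<beta>"

lemma Dbar_eq: "Dbar x y = D x y + deformation x y"
  by (simp add: generalized_symmetric_metric_connection_def deformation_def)

lemmas all_closed = closed D_field alpha_smooth beta_smooth

lemma deformation_field:
  "x \<in> vector_fields A \<Longrightarrow> y \<in> vector_fields A \<Longrightarrow> deformation x y \<in> vector_fields A"
  unfolding deformation_def by (intro all_closed)

lemma deformation_add_right: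
  "\<lbrakk>x \<in> vector_fields A; y \<in> vector_fields A; z \<in> vector_fields A\<rbrakk>
    \<Longrightarrow> deformation x (y + z) = deformation x y + deformation x z"
  by (simp add: deformation_def g_linear eta_add all_closed pointwise algebra_simps)

text \<open>Meant for the bracket term of the curvature, where torsion-freeness puts D x y - D y x
  into the first slot.\<close>

lemma deformation_diff_left:
  "\<lbrakk>x \<in> vector_fields A; y \<in> vector_fields A; z \<in> vector_fields A\<rbrakk>
    \<Longrightarrow> deformation (x - y) z = deformation x z - deformation y z"
  by (simp add: deformation_def g_linear phi_diff all_closed pointwise algebra_simps)

text \<open>The product rule, with the derivatives of \<xi>, \<eta> and \<phi> inserted. The
  derivative of \<phi> enters twice, in g(\<phi> y, z) \<xi> and in \<eta>(z) \<phi> y; its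
  \<xi>-components cancel between the two, and only its part -\<eta>(y) x leaves a trace, in the
  last two terms.\<close>

lemma D_deformation:
  assumes "x \<in> vector_fields A" "y \<in> vector_fields A" "z \<in> vector_fields A"
  shows "D x (deformation y z) = deformation (D x y) z + deformation y (D x z)
    + dir x \<alpha> \<odot> (g \<diamondop> y \<diamondop> z \<odot> \<xi> - \<eta> \<diamondop> z \<odot> y)
    + \<alpha> \<odot> (g \<diamondop> y \<diamondop> z \<odot> (\<phi> \<diamondop> x) - g \<diamondop> (\<phi> \<diamondop> x) \<diamondop> z \<odot> y)
    + dir x \<beta> \<odot> (g \<diamondop> (\<phi> \<diamondop> y) \<diamondop> z \<odot> \<xi> - \<eta> \<diamondop> z \<odot> (\<phi> \<diamondop> y))
    + \<beta> \<odot> (g \<diamondop> (\<phi> \<diamondop> y) \<diamondop> z \<odot> (\<phi> \<diamondop> x) - g \<diamondop> (\<phi> \<diamondop> x) \<diamondop> z \<odot> (\<phi> \<diamondop> y)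
      + (\<eta> \<diamondop> y * \<eta> \<diamondop> z) \<odot> x - (\<eta> \<diamondop> y * g \<diamondop> x \<diamondop> z) \<odot> \<xi>)"
proof -
  note [simp] = assms
  \<comment> \<open>The coefficient 2 \<eta>(x) \<eta>(y) in \<open>D_phi\<close> must be smooth
    before it can be pulled out of the first slot of the metric.\<close>
  have 2: "2 \<in> smooth_functions A"
    using smooth_functions_const[of 2] by (simp add: numeral_fun)
  have xi: "g \<diamondop> \<xi> \<diamondop> z = \<eta> \<diamondop> z"
    using g_commute[of \<xi> z] by (simp add: eta_eq_g_xi closed)
  have 1: "dir x (g \<diamondop> (\<phi> \<diamondop> y) \<diamondop> z) = g \<diamondop> (\<phi> \<diamondop> D x y) \<diamondop> z + g \<diamondop> (\<phi> \<diamondop> y) \<diamondop> D x z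
     - g \<diamondop> x \<diamondop> y * \<eta> \<diamondop> z - \<eta> \<diamondop> y * g \<diamondop> x \<diamondop> z + 2 * \<eta> \<diamondop> x * \<eta> \<diamondop> y * \<eta> \<diamondop> z"
    by (simp add: dir_g D_phi 2 all_closed g_linear xi)
  show ?thesis
    \<comment> \<open>The derivation rules match whole fields, so they are applied before the
      equation is evaluated pointwise.\<close>
    by (simp add: deformation_def D_add D_diff D_fscale all_closed 1 dir_g dir_eta D_xi D_phi)
       (simp add: pointwise algebra_simps)
qed

text \<open>Since T(y, z) = P \<xi> - \<eta>(z) (\<alpha> y + \<beta> \<phi> y), linearity in the
  second slot reduces the iterate to T(x, \<xi>), T(x, y) and T(x, \<phi> y). The bracket after
  \<open>P\<close> is T(x, \<xi>), simplified by \<open>eta_phi\<close>.\<close>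

lemma deformation_deformation:
  assumes "x \<in> vector_fields A" "y \<in> vector_fields A" "z \<in> vector_fields A"
  defines "P \<equiv> \<alpha> * g \<diamondop> y \<diamondop> z + \<beta> * g \<diamondop> (\<phi> \<diamondop> y) \<diamondop> z"
  shows "deformation x (deformation y z) =
    P \<odot> (\<alpha> \<odot> (\<eta> \<diamondop> x \<odot> \<xi> - x) - \<beta> \<odot> (\<phi> \<diamondop> x))
    - (\<eta> \<diamondop> z) \<odot> (\<alpha> \<odot> deformation x y + \<beta> \<odot> deformation x (\<phi> \<diamondop> y))"
  using assms(1-3)
  by (simp add: P_def deformation_def all_closed g_linear eta_add eta_diff eta_fscale eta_phi
      eta_xi eta_eq_g_xi[symmetric])
    (simp add: pointwise algebra_simps)

text \<open>The first two parentheses are covariant derivatives of T. Their terms with a derivative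
  of z come from the iterated connection, and those with D x y or D y x from T([x, y], z).\<close>

lemma curvature_Dbar:
  assumes "x \<in> vector_fields A" "y \<in> vector_fields A" "z \<in> vector_fields A"
  shows "curvature Dbar x y z = curvature D x y z
    + (D x (deformation y z) - deformation (D x y) z - deformation y (D x z))
    - (D y (deformation x z) - deformation (D y x) z - deformation x (D y z))
    + deformation x (deformation y z) - deformation y (deformation x z)"
  using assms
  by (simp add: curvature_def Dbar_eq D_add deformation_add_right all_closed deformation_field
      lie_bracket_eq deformation_diff_left)

end

theorem proposition3:
  fixes A :: "('a::{t2_space, second_countable_topology}, 'e::euclidean_space) atlas"
    and n :: nat
    and \<phi> :: "'a \<Rightarrow> 'a tangent \<Rightarrow> 'a tangent"
    and \<xi> :: "'a \<Rightarrow> 'a tangent"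
    and \<eta> :: "'a \<Rightarrow> 'a tangent \<Rightarrow> real"
    and g :: "'a \<Rightarrow> 'a tangent \<Rightarrow> 'a tangent \<Rightarrow> real"
    and D :: "'a connection"
    and \<alpha> \<beta> :: "'a \<Rightarrow> real"
    and x y z :: "'a \<Rightarrow> 'a tangent"
  assumes "apapR_manifold A n \<phi> \<xi> \<eta> g"
    and "levi_civita A g D"
    and "para_Sasaki_like A \<phi> \<xi> \<eta> g D"
    and "\<alpha> \<in> smooth_functions A" and "\<beta> \<in> smooth_functions A"
    and "x \<in> vector_fields A" and "y \<in> vector_fields A" and "z \<in> vector_fields A"
  shows "curvature (generalized_symmetric_metric_connection \<phi> \<xi> \<eta> g D \<alpha> \<beta>) x y z =
      curvature D x y z
      + (dir x \<alpha> * (g \<diamondop> y \<diamondop> z)) \<odot> \<xi>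
      + ((\<alpha> - \<alpha> * \<beta>) * (g \<diamondop> y \<diamondop> z)) \<odot> (\<phi> \<diamondop> x)
      - (dir x \<alpha> * (\<eta> \<diamondop> z)) \<odot> y
      + (dir x \<beta> * (g \<diamondop> (\<phi> \<diamondop> y) \<diamondop> z)) \<odot> \<xi>
      + ((2 * \<beta> - \<beta>\<^sup>2) * (g \<diamondop> (\<phi> \<diamondop> y) \<diamondop> z)) \<odot> (\<phi> \<diamondop> x)
      - (dir x \<beta> * (\<eta> \<diamondop> z)) \<odot> (\<phi> \<diamondop> y)
      + ((\<alpha>\<^sup>2 + \<beta>) * (g \<diamondop> y \<diamondop> z) * (\<eta> \<diamondop> x)) \<odot> \<xi>
      + (\<alpha> * \<beta> * (g \<diamondop> (\<phi> \<diamondop> y) \<diamondop> z) * (\<eta> \<diamondop> x)) \<odot> \<xi>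
      - (\<alpha>\<^sup>2 * (g \<diamondop> y \<diamondop> z)) \<odot> x
      + ((\<alpha>\<^sup>2 + \<beta>) * (\<eta> \<diamondop> y) * (\<eta> \<diamondop> z)) \<odot> x
      + ((\<alpha> - \<alpha> * \<beta>) * (g \<diamondop> (\<phi> \<diamondop> y) \<diamondop> z)) \<odot> x
      + (\<alpha> * \<beta> * (\<eta> \<diamondop> y) * (\<eta> \<diamondop> z)) \<odot> (\<phi> \<diamondop> x)
      - (dir y \<alpha> * (g \<diamondop> x \<diamondop> z)) \<odot> \<xi>
      + (dir y \<alpha> * (\<eta> \<diamondop> z)) \<odot> x
      - (dir y \<beta> * (g \<diamondop> (\<phi> \<diamondop> x) \<diamondop> z)) \<odot> \<xi>
      + ((\<beta>\<^sup>2 - 2 * \<beta>) * (g \<diamondop> (\<phi> \<diamondop> x) \<diamondop> z)) \<odot> (\<phi> \<diamondop> y)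
      + (dir y \<beta> * (\<eta> \<diamondop> z)) \<odot> (\<phi> \<diamondop> x)
      - ((\<alpha>\<^sup>2 + \<beta>) * (\<eta> \<diamondop> y) * (g \<diamondop> x \<diamondop> z)) \<odot> \<xi>
      - (\<alpha> * \<beta> * (g \<diamondop> (\<phi> \<diamondop> x) \<diamondop> z) * (\<eta> \<diamondop> y)) \<odot> \<xi>
      + (\<alpha>\<^sup>2 * (g \<diamondop> x \<diamondop> z)) \<odot> y
      - ((\<alpha>\<^sup>2 + \<beta>) * (\<eta> \<diamondop> x) * (\<eta> \<diamondop> z)) \<odot> y
      + ((\<alpha> * \<beta> - \<alpha>) * (g \<diamondop> (\<phi> \<diamondop> x) \<diamondop> z)) \<odot> y
      - (\<alpha> * \<beta> * (\<eta> \<diamondop> x) * (\<eta> \<diamondop> z)) \<odot> (\<phi> \<diamondop> y)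
      + ((\<alpha> * \<beta> - \<alpha>) * (g \<diamondop> x \<diamondop> z)) \<odot> (\<phi> \<diamondop> y)"
proof -
  interpret deformed_para_Sasaki_like_manifold A n \<phi> \<xi> \<eta> g D \<alpha> \<beta>
    using assms
    by (simp add: deformed_para_Sasaki_like_manifold_def
        deformed_para_Sasaki_like_manifold_axioms_def para_Sasaki_like_manifold_def
        para_Sasaki_like_manifold_axioms_def)
  note fields = assms(6-8)
  \<comment> \<open>The \<xi>-parts of T(x, y) and T(x, \<phi> y) involve g(x, y), g(\<phi> x, y)
    and g(\<phi> x, \<phi> y), all symmetric in x and y. They therefore cancel when x and y are
    interchanged and the results subtracted.\<close>
  have "g \<diamondop> (\<phi> \<diamondop> y) \<diamondop> x = g \<diamondop> (\<phi> \<diamondop> x) \<diamondop> y"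
    using g_phi_commute[OF fields(2,1)] g_commute[of "\<phi> \<diamondop> x" y] fields by (simp add: phi_field)
  then show ?thesis
    using fields g_commute[OF fields(2,1)] g_phi_phi[OF fields(1,2)]
      g_phi_phi[OF fields(2,1)]
    \<comment> \<open>\<open>deformation\<close> stays folded at first, so that the terms containing
      D x y, D y x, D x z and D y z cancel as units; unfolding then concerns only the remains of the
      iterated terms.\<close>
    by ((simp add: curvature_Dbar D_deformation deformation_deformation),
        (simp add: deformation_def g_phi_commute phi_field eta_phi),
        (simp add: pointwise power2_eq_square algebra_simps))
qed

end
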